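(* Let $G$ be a group. If $N$ is a minimal normal subgroup of $G$, then $N\leq P(G)$, where $P(G)$ denotes the pseudocentre of $G$.
   Context: For a group $G$, the pseudocentre is $P(G)=\bigcap_{x\in G}C_G(x)^G$, where $C_G(x)$ is the centralizer of $x$ in $G$ and, for a subgroup $H\leq G$, $H^G$ is the normal closure of $H$ in $G$ (the smallest normal subgroup of $G$ containing $H$). A minimal normal subgroup is a non-trivial normal subgroup of $G$ containing no non-trivial normal subgroup of $G$ other than itself. *)

theory Defs
  imports "HOL-Algebra.Coset" "HOL.Hull"
begin

definition centralizer :: "('a, 'b) monoid_scheme \<Rightarrow> 'a \<Rightarrow> 'a set" where
  "centralizer G x = {g \<in> carrier G. g \<otimes>\<^bsub>G\<^esub> x = x \<otimes>\<^bsub>G\<^esub> g}"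

definition normal_closure :: "('a, 'b) monoid_scheme \<Rightarrow> 'a set \<Rightarrow> 'a set" where
  "normal_closure G H = (\<lambda>M. M \<lhd> G) hull H"

definition pseudocentre :: "('a, 'b) monoid_scheme \<Rightarrow> 'a set" where
  "pseudocentre G = (\<Inter>x\<in>carrier G. normal_closure G (centralizer G x))"

definition minimal_normal_subgroup :: "'a set \<Rightarrow> ('a, 'b) monoid_scheme \<Rightarrow> bool" where
  "minimal_normal_subgroup N G \<longleftrightarrow>
     N \<lhd> G \<and> N \<noteq> {\<one>\<^bsub>G\<^esub>} \<and> (\<forall>M. M \<lhd> G \<and> M \<noteq> {\<one>\<^bsub>G\<^esub>} \<and> M \<subseteq> N \<longrightarrow> M = N)"

lemma (in group) subgroup_centralizer:
  assumes x: "x \<in> carrier G"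
  shows "subgroup (centralizer G x) G"
proof (rule subgroupI)
  show "centralizer G x \<subseteq> carrier G"
    by (auto simp: centralizer_def)
  show "centralizer G x \<noteq> {}"
    using x by (auto simp: centralizer_def)
next
  fix a assume "a \<in> centralizer G x"
  then have a: "a \<in> carrier G" "a \<otimes> x = x \<otimes> a"
    by (auto simp: centralizer_def)
  have "a \<otimes> (x \<otimes> inv a) = x"
    using a x by (simp flip: m_assoc) (simp add: m_assoc)
  then have "x \<otimes> inv a = inv a \<otimes> x"
    using a x by (metis inv_closed inv_solve_left m_closed)
  then show "inv a \<in> centralizer G x"
    using a by (simp add: centralizer_def)
next
  fix a b assume "a \<in> centralizer G x" "b \<in> centralizer G x"
  then have ab: "a \<in> carrier G" "a \<otimes> x = x \<otimes> a" "b \<in> carrier G" "b \<otimes> x = x \<otimes> b"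
    by (auto simp: centralizer_def)
  then have "a \<otimes> b \<otimes> x = x \<otimes> (a \<otimes> b)"
    using x by (metis m_assoc)
  then show "a \<otimes> b \<in> centralizer G x"
    using ab by (simp add: centralizer_def)
qed

lemma (in group) normal_Inter:
  assumes "\<And>M. M \<in> A \<Longrightarrow> M \<lhd> G" "A \<noteq> {}"
  shows "\<Inter>A \<lhd> G"
proof -
  have "subgroup (\<Inter>A) G"
    using assms by (intro subgroups_Inter) (auto simp: normal_imp_subgroup)
  moreover have "x \<otimes> h \<otimes> inv x \<in> \<Inter>A" if "x \<in> carrier G" "h \<in> \<Inter>A" for x h
    using assms that by (auto intro: normal.inv_op_closed2)
  ultimately show ?thesis
    by (simp add: normal_inv_iff)
qed

lemma (in group) normal_normal_closure:
  assumes "H \<subseteq> carrier G"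
  shows "normal_closure G H \<lhd> G"
proof -
  have "carrier G \<lhd> G"
    by (simp add: normal_inv_iff subgroup_self)
  then show ?thesis
    unfolding normal_closure_def hull_def using assms by (intro normal_Inter) auto
qed

lemma subset_normal_closure: "H \<subseteq> normal_closure G H"
  by (simp add: normal_closure_def hull_subset)

lemma normal_closure_minimal: "H \<subseteq> M \<Longrightarrow> M \<lhd> G \<Longrightarrow> normal_closure G H \<subseteq> M"
  by (simp add: normal_closure_def hull_minimal)

lemma (in group) normal_pseudocentre: "pseudocentre G \<lhd> G"
  unfolding pseudocentre_def
  by (rule normal_Inter) (auto intro: normal_normal_closure simp: centralizer_def)

end

(* If N meets the normal closure M of C(x) trivially, then N and M commute elementwise.
   As x lies in M, this puts N inside C(x), hence inside M.  Otherwise minimality of N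
   gives N \<inter> M = N.  Either way N is contained in M. *)

theory Submission
  imports Defs
begin

text \<open>The commutator of \<open>n\<close> and \<open>m\<close> lies in \<open>M\<close> as a
  conjugate of \<open>m\<close> times \<open>inv m\<close>, and in \<open>N\<close> as
  \<open>n\<close> times a conjugate of \<open>inv n\<close>; a trivial intersection forces it to be
  \<open>\<one>\<close>.\<close>

lemma (in group) normal_Int_trivial_commute:
  assumes N: "N \<lhd> G" and M: "M \<lhd> G" and triv: "N \<inter> M = {\<one>}"
    and n: "n \<in> N" and m: "m \<in> M"
  shows "n \<otimes> m = m \<otimes> n"
proof -
  interpret N: normal N G by (rule N)
  interpret M: normal M G by (rule M)
  have [simp]: "n \<in> carrier G" "m \<in> carrier G"
    using n m by auto
  have "(n \<otimes> m \<otimes> inv n) \<otimes> inv m \<in> M"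
    using m by (intro M.m_closed M.inv_op_closed2 M.m_inv_closed) auto
  moreover have "n \<otimes> (m \<otimes> inv n \<otimes> inv m) \<in> N"
    using n by (intro N.m_closed N.inv_op_closed2 N.m_inv_closed) auto
  ultimately have "(n \<otimes> m) \<otimes> inv (m \<otimes> n) = \<one>"
    using triv by (auto simp: m_assoc inv_mult_group)
  \<comment> \<open>\<open>n \<otimes> m\<close> is a left inverse of
    \<open>inv (m \<otimes> n)\<close>, hence equal to its inverse
    \<open>m \<otimes> n\<close>.\<close>
  then show ?thesis
    using inv_equality[of "n \<otimes> m" "inv (m \<otimes> n)"] by simp
qed

lemma (in group) minimal_normal_subset_normal_closure_centralizer:
  assumes min: "minimal_normal_subgroup N G" and x: "x \<in> carrier G"
  shows "N \<subseteq> normal_closure G (centralizer G x)"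
proof -
  define M where "M = normal_closure G (centralizer G x)"
  have N: "N \<lhd> G"
    using min by (simp add: minimal_normal_subgroup_def)
  have M: "M \<lhd> G"
    unfolding M_def by (rule normal_normal_closure) (auto simp: centralizer_def)
  have CM: "centralizer G x \<subseteq> M"
    unfolding M_def by (rule subset_normal_closure)
  have "N \<subseteq> M"
  proof (cases "N \<inter> M = {\<one>}")
    case True
    \<comment> \<open>Since \<open>x\<close> commutes with itself, it lies in its own centralizer;
      this makes \<open>x\<close> an admissible \<open>m\<close> in the commutation lemma.\<close>
    have "x \<in> M"
      using CM x by (auto simp: centralizer_def)
    then have "N \<subseteq> centralizer G x"
      using normal_Int_trivial_commute[OF N M True] normal_imp_subgroup[OF N]
      by (auto simp: centralizer_def dest: subgroup.mem_carrier)
    with CM show ?thesis by blast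
  next
    case False
    moreover have "N \<inter> M \<lhd> G"
      using N M by (rule normal_subgroup_intersect)
    ultimately have "N \<inter> M = N"
      using min by (simp add: minimal_normal_subgroup_def)
    then show ?thesis by blast
  qed
  then show ?thesis by (simp add: M_def)
qed

theorem theorem2p1:
  fixes G :: "('a, 'b) monoid_scheme" and N :: "'a set"
  assumes "group G"
    and "minimal_normal_subgroup N G"
  shows "N \<subseteq> pseudocentre G"
  unfolding pseudocentre_def
  using group.minimal_normal_subset_normal_closure_centralizer[OF assms] by blast

end
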